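(* Let $R$ be a ring, let $M$ be a compressible left $R$-module, and let $M'$ be the quasi-injective hull of $M$. If every nonzero $f\in \mathrm{Hom}_R(M,M')$ is a monomorphism, then $M$ is critically compressible.
   Context: Rings are associative with identity $1\neq 0$; modules are unitary left modules. A nonzero module $M$ is compressible if for every nonzero submodule $N\le M$ there is a monomorphism $M\to N$. A module $M$ is critically compressible if it is compressible and, in addition, there is no monomorphism $M\to M/N$ for any nonzero submodule $N\le M$. A module $Q$ is quasi-injective if for every submodule $Q_1\le Q$, any homomorphism $Q_1\to Q$ extends to a homomorphism $Q\to Q$. The quasi-injective hull of $M$ is the smallest quasi-injective submodule of the injective hull $E(M)$ containing $M$. *)

theory Defs
  imports "HOL-Algebra.Module" "HOL-Algebra.AbelCoset"
begin

text \<open>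
  The library locale \<open>module\<close> demands a commutative ring of scalars.  The locale below keeps
  its record type and its axioms but allows an arbitrary ring.  The fields \<open>mult\<close> and
  \<open>one\<close> that the record inherits are irrelevant.
\<close>

locale left_module = R?: ring R + M?: abelian_group M
  for R :: "('r, 'a) ring_scheme" (structure)
    and M :: "('r, 'm, 'b) module_scheme" (structure) +
  assumes smult_closed [simp, intro]:
      "\<lbrakk>a \<in> carrier R; x \<in> carrier M\<rbrakk> \<Longrightarrow> a \<odot>\<^bsub>M\<^esub> x \<in> carrier M"
    and smult_l_distr:
      "\<lbrakk>a \<in> carrier R; b \<in> carrier R; x \<in> carrier M\<rbrakk> \<Longrightarrow>
        (a \<oplus>\<^bsub>R\<^esub> b) \<odot>\<^bsub>M\<^esub> x = a \<odot>\<^bsub>M\<^esub> x \<oplus>\<^bsub>M\<^esub> b \<odot>\<^bsub>M\<^esub> x"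
    and smult_r_distr:
      "\<lbrakk>a \<in> carrier R; x \<in> carrier M; y \<in> carrier M\<rbrakk> \<Longrightarrow>
        a \<odot>\<^bsub>M\<^esub> (x \<oplus>\<^bsub>M\<^esub> y) = a \<odot>\<^bsub>M\<^esub> x \<oplus>\<^bsub>M\<^esub> a \<odot>\<^bsub>M\<^esub> y"
    and smult_assoc1:
      "\<lbrakk>a \<in> carrier R; b \<in> carrier R; x \<in> carrier M\<rbrakk> \<Longrightarrow>
        (a \<otimes>\<^bsub>R\<^esub> b) \<odot>\<^bsub>M\<^esub> x = a \<odot>\<^bsub>M\<^esub> (b \<odot>\<^bsub>M\<^esub> x)"
    and smult_one [simp]:
      "x \<in> carrier M \<Longrightarrow> \<one>\<^bsub>R\<^esub> \<odot>\<^bsub>M\<^esub> x = x"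

definition lmod_hom ::
    "('r, 'a) ring_scheme \<Rightarrow> ('r, 'm, 'b) module_scheme \<Rightarrow> ('r, 'n, 'c) module_scheme \<Rightarrow> ('m \<Rightarrow> 'n) set"
  where "lmod_hom R M N =
    {h \<in> carrier M \<rightarrow> carrier N.
      (\<forall>x\<in>carrier M. \<forall>y\<in>carrier M. h (x \<oplus>\<^bsub>M\<^esub> y) = h x \<oplus>\<^bsub>N\<^esub> h y) \<and>
      (\<forall>a\<in>carrier R. \<forall>x\<in>carrier M. h (a \<odot>\<^bsub>M\<^esub> x) = a \<odot>\<^bsub>N\<^esub> h x)}"

definition lmod_mono ::
    "('r, 'a) ring_scheme \<Rightarrow> ('r, 'm, 'b) module_scheme \<Rightarrow> ('r, 'n, 'c) module_scheme \<Rightarrow> ('m \<Rightarrow> 'n) set"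
  where "lmod_mono R M N = {h \<in> lmod_hom R M N. inj_on h (carrier M)}"

text \<open>A submodule is a subset, as in the library; as a module of its own it is the following.\<close>

abbreviation sub_lmod :: "('r, 'm, 'b) module_scheme \<Rightarrow> 'm set \<Rightarrow> ('r, 'm, 'b) module_scheme"
  where "sub_lmod M N \<equiv> M\<lparr>carrier := N\<rparr>"

text \<open>
  On cosets, \<open>a \<cdot> (N + x) = N + a x\<close>, written without choosing a representative (in the
  same way as \<open>rcoset_mult\<close> does it for quotient rings).
\<close>

definition quot_lmod :: "('r, 'm, 'b) module_scheme \<Rightarrow> 'm set \<Rightarrow> ('r, 'm set) module"
  where "quot_lmod M N =
    \<lparr>carrier = a_rcosets\<^bsub>M\<^esub> N, mult = undefined, one = undefined,
     zero = N, add = set_add M,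
     smult = (\<lambda>a X. \<Union>x\<in>X. N +>\<^bsub>M\<^esub> (a \<odot>\<^bsub>M\<^esub> x))\<rparr>"

definition compressible :: "('r, 'a) ring_scheme \<Rightarrow> ('r, 'm, 'b) module_scheme \<Rightarrow> bool"
  where "compressible R M \<longleftrightarrow>
    left_module R M \<and> carrier M \<noteq> {\<zero>\<^bsub>M\<^esub>} \<and>
    (\<forall>N. submodule N R M \<and> N \<noteq> {\<zero>\<^bsub>M\<^esub>} \<longrightarrow> lmod_mono R M (sub_lmod M N) \<noteq> {})"

definition critically_compressible :: "('r, 'a) ring_scheme \<Rightarrow> ('r, 'm, 'b) module_scheme \<Rightarrow> bool"
  where "critically_compressible R M \<longleftrightarrow>
    compressible R M \<and>
    (\<forall>N. submodule N R M \<and> N \<noteq> {\<zero>\<^bsub>M\<^esub>} \<longrightarrow> lmod_mono R M (quot_lmod M N) = {})"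

definition quasi_injective :: "('r, 'a) ring_scheme \<Rightarrow> ('r, 'm, 'b) module_scheme \<Rightarrow> bool"
  where "quasi_injective R Q \<longleftrightarrow>
    left_module R Q \<and>
    (\<forall>P. submodule P R Q \<longrightarrow>
      (\<forall>g \<in> lmod_hom R (sub_lmod Q P) Q. \<exists>h \<in> lmod_hom R Q Q. \<forall>x\<in>P. h x = g x))"

text \<open>
  A formula cannot quantify over the types of the test modules, so they are drawn from a type that
  contains a copy of the scalars and of \<open>E\<close>.  This is no restriction: by Baer's argument the
  extension property then holds for test modules over arbitrary types, see
  \<open>injective_lmod_extends\<close> below.
\<close>

definition injective_lmod :: "('r, 'a) ring_scheme \<Rightarrow> ('r, 'e, 'b) module_scheme \<Rightarrow> bool"
  where "injective_lmod R E \<longleftrightarrow>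
    left_module R E \<and>
    (\<forall>(A :: ('r, 'r + 'e) module) (B :: ('r, 'r + 'e) module).
      left_module R A \<and> left_module R B \<longrightarrow>
      (\<forall>f \<in> lmod_mono R A B. \<forall>g \<in> lmod_hom R A E.
        \<exists>h \<in> lmod_hom R B E. \<forall>x\<in>carrier A. h (f x) = g x))"

definition essential_submodule :: "('r, 'a) ring_scheme \<Rightarrow> ('r, 'e, 'b) module_scheme \<Rightarrow> 'e set \<Rightarrow> bool"
  where "essential_submodule R E L \<longleftrightarrow>
    submodule L R E \<and>
    (\<forall>N. submodule N R E \<and> N \<noteq> {\<zero>\<^bsub>E\<^esub>} \<longrightarrow> L \<inter> N \<noteq> {\<zero>\<^bsub>E\<^esub>})"

text \<open>The injective hull is determined up to isomorphism only; it comes with an embedding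
  \<open>\<iota>\<close> of \<open>M\<close>.\<close>

definition injective_hull ::
    "('r, 'a) ring_scheme \<Rightarrow> ('r, 'm, 'b) module_scheme \<Rightarrow> ('r, 'e, 'c) module_scheme \<Rightarrow> ('m \<Rightarrow> 'e) \<Rightarrow> bool"
  where "injective_hull R M E \<iota> \<longleftrightarrow>
    left_module R M \<and> injective_lmod R E \<and> \<iota> \<in> lmod_mono R M E \<and>
    essential_submodule R E (\<iota> ` carrier M)"

definition quasi_injective_hull ::
    "('r, 'a) ring_scheme \<Rightarrow> ('r, 'm, 'b) module_scheme \<Rightarrow> ('r, 'e, 'c) module_scheme \<Rightarrow> ('m \<Rightarrow> 'e) \<Rightarrow>
      'e set \<Rightarrow> bool"
  where "quasi_injective_hull R M E \<iota> Q \<longleftrightarrow>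
    injective_hull R M E \<iota> \<and>
    submodule Q R E \<and> quasi_injective R (sub_lmod E Q) \<and> \<iota> ` carrier M \<subseteq> Q \<and>
    (\<forall>P. submodule P R E \<and> quasi_injective R (sub_lmod E P) \<and> \<iota> ` carrier M \<subseteq> P \<longrightarrow> Q \<subseteq> P)"

lemma lmod_homD:
  assumes "h \<in> lmod_hom R M N"
  shows "x \<in> carrier M \<Longrightarrow> h x \<in> carrier N"
    and "x \<in> carrier M \<Longrightarrow> y \<in> carrier M \<Longrightarrow> h (x \<oplus>\<^bsub>M\<^esub> y) = h x \<oplus>\<^bsub>N\<^esub> h y"
    and "a \<in> carrier R \<Longrightarrow> x \<in> carrier M \<Longrightarrow> h (a \<odot>\<^bsub>M\<^esub> x) = a \<odot>\<^bsub>N\<^esub> h x"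
  using assms unfolding lmod_hom_def by auto

context left_module
begin

lemma smult_zero_left: assumes "x \<in> carrier M" shows "\<zero>\<^bsub>R\<^esub> \<odot>\<^bsub>M\<^esub> x = \<zero>\<^bsub>M\<^esub>"
proof -
  have "\<zero>\<^bsub>R\<^esub> \<odot>\<^bsub>M\<^esub> x = \<zero>\<^bsub>R\<^esub> \<odot>\<^bsub>M\<^esub> x \<oplus>\<^bsub>M\<^esub> \<zero>\<^bsub>R\<^esub> \<odot>\<^bsub>M\<^esub> x"
    using smult_l_distr[of "\<zero>\<^bsub>R\<^esub>" "\<zero>\<^bsub>R\<^esub>" x] assms by simp
  then show ?thesis
    using assms by (metis M.add.r_cancel_one' R.zero_closed smult_closed)
qed

lemma smult_neg_one: assumes "x \<in> carrier M" shows "(\<ominus>\<^bsub>R\<^esub> \<one>\<^bsub>R\<^esub>) \<odot>\<^bsub>M\<^esub> x = \<ominus>\<^bsub>M\<^esub> x"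
proof -
  have "(\<ominus>\<^bsub>R\<^esub> \<one>\<^bsub>R\<^esub>) \<odot>\<^bsub>M\<^esub> x \<oplus>\<^bsub>M\<^esub> x = (\<ominus>\<^bsub>R\<^esub> \<one>\<^bsub>R\<^esub> \<oplus>\<^bsub>R\<^esub> \<one>\<^bsub>R\<^esub>) \<odot>\<^bsub>M\<^esub> x"
    using assms by (subst smult_l_distr) auto
  also have "\<dots> = \<zero>\<^bsub>M\<^esub>" using assms by (simp add: R.l_neg smult_zero_left)
  finally show ?thesis
    using assms by (metis M.minus_equality R.add.inv_closed R.one_closed smult_closed)
qed

lemma smult_zero_right: assumes "a \<in> carrier R" shows "a \<odot>\<^bsub>M\<^esub> \<zero>\<^bsub>M\<^esub> = \<zero>\<^bsub>M\<^esub>"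
proof -
  have "a \<odot>\<^bsub>M\<^esub> \<zero>\<^bsub>M\<^esub> = a \<odot>\<^bsub>M\<^esub> \<zero>\<^bsub>M\<^esub> \<oplus>\<^bsub>M\<^esub> a \<odot>\<^bsub>M\<^esub> \<zero>\<^bsub>M\<^esub>"
    using smult_r_distr[of a "\<zero>\<^bsub>M\<^esub>" "\<zero>\<^bsub>M\<^esub>"] assms by simp
  then show ?thesis
    using assms by (metis M.add.r_cancel_one' M.zero_closed smult_closed)
qed

lemma sub_lmod_left_module:
  assumes "submodule N R M"
  shows "left_module R (sub_lmod M N)"
proof -
  interpret N: submodule N R M by fact
  have sub: "x \<in> carrier M" if "x \<in> N" for x using that N.subset by auto
  have "abelian_group (sub_lmod M N)"
  proof (rule abelian_groupI)
    fix x assume "x \<in> carrier (sub_lmod M N)"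
    then show "\<exists>y\<in>carrier (sub_lmod M N). y \<oplus>\<^bsub>sub_lmod M N\<^esub> x = \<zero>\<^bsub>sub_lmod M N\<^esub>"
      using N.smult_closed[of "\<ominus>\<^bsub>R\<^esub> \<one>\<^bsub>R\<^esub>" x] sub[of x]
      by (auto intro!: bexI[of _ "\<ominus>\<^bsub>M\<^esub> x"] simp: M.l_neg smult_neg_one)
  next
    show "x \<oplus>\<^bsub>sub_lmod M N\<^esub> y = y \<oplus>\<^bsub>sub_lmod M N\<^esub> x"
      if "x \<in> carrier (sub_lmod M N)" "y \<in> carrier (sub_lmod M N)" for x y
      using that by (simp add: sub M.a_comm)
  qed (use N.m_closed N.one_closed in \<open>auto simp: sub M.a_assoc\<close>)
  then interpret S: abelian_group "sub_lmod M N" .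
  show ?thesis
    by unfold_locales (auto simp: sub smult_l_distr smult_r_distr smult_assoc1)
qed

lemma submoduleI_closed:
  assumes "N \<subseteq> carrier M" "\<zero>\<^bsub>M\<^esub> \<in> N"
    and "\<And>x y. x \<in> N \<Longrightarrow> y \<in> N \<Longrightarrow> x \<oplus>\<^bsub>M\<^esub> y \<in> N"
    and smult: "\<And>a x. a \<in> carrier R \<Longrightarrow> x \<in> N \<Longrightarrow> a \<odot>\<^bsub>M\<^esub> x \<in> N"
  shows "submodule N R M"
proof -
  have "\<ominus>\<^bsub>M\<^esub> x \<in> N" if "x \<in> N" for x
    using smult[of "\<ominus>\<^bsub>R\<^esub> \<one>\<^bsub>R\<^esub>" x] that assms(1) by (auto simp: smult_neg_one subset_iff)
  then have "subgroup N (add_monoid M)"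
    using assms by (unfold_locales) (auto simp: a_inv_def)
  then show ?thesis
    using smult by (simp add: submodule_def submodule_axioms_def)
qed

lemma quot_lmod_smult:
  assumes "submodule N R M" "a \<in> carrier R" "x \<in> carrier M"
  shows "a \<odot>\<^bsub>quot_lmod M N\<^esub> (N +>\<^bsub>M\<^esub> x) = N +>\<^bsub>M\<^esub> (a \<odot>\<^bsub>M\<^esub> x)"
proof -
  interpret N: submodule N R M by fact
  have eq: "N +>\<^bsub>M\<^esub> (a \<odot>\<^bsub>M\<^esub> y) = N +>\<^bsub>M\<^esub> (a \<odot>\<^bsub>M\<^esub> x)" if y: "y \<in> N +>\<^bsub>M\<^esub> x" for y
  proof -
    obtain n where n: "n \<in> N" "y = n \<oplus>\<^bsub>M\<^esub> x"
      using y by (auto simp: a_r_coset_def')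
    then have nc: "n \<in> carrier M" using N.subset by auto
    have "a \<odot>\<^bsub>M\<^esub> y = a \<odot>\<^bsub>M\<^esub> n \<oplus>\<^bsub>M\<^esub> a \<odot>\<^bsub>M\<^esub> x"
      using n nc assms by (simp add: smult_r_distr)
    then have "a \<odot>\<^bsub>M\<^esub> y \<in> N +>\<^bsub>M\<^esub> (a \<odot>\<^bsub>M\<^esub> x)"
      using n assms(2) by (auto simp: a_r_coset_def')
    then show ?thesis
      using M.add.repr_independence[of "a \<odot>\<^bsub>M\<^esub> y" N "a \<odot>\<^bsub>M\<^esub> x"] assms N.subgroup_axioms
      by (simp add: a_r_coset_def)
  qed
  have self: "x \<in> N +>\<^bsub>M\<^esub> x"
    using N.one_closed assms(3) by (force simp: a_r_coset_def')
  have "(\<Union>y\<in>N +>\<^bsub>M\<^esub> x. N +>\<^bsub>M\<^esub> (a \<odot>\<^bsub>M\<^esub> y)) = (\<Union>y\<in>N +>\<^bsub>M\<^esub> x. N +>\<^bsub>M\<^esub> (a \<odot>\<^bsub>M\<^esub> x))"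
    by (rule SUP_cong[OF refl eq])
  also have "\<dots> = N +>\<^bsub>M\<^esub> (a \<odot>\<^bsub>M\<^esub> x)" using self by blast
  finally show ?thesis by (simp add: quot_lmod_def)
qed

lemma quot_lmod_add:
  assumes "submodule N R M" "x \<in> carrier M" "y \<in> carrier M"
  shows "(N +>\<^bsub>M\<^esub> x) \<oplus>\<^bsub>quot_lmod M N\<^esub> (N +>\<^bsub>M\<^esub> y) = N +>\<^bsub>M\<^esub> (x \<oplus>\<^bsub>M\<^esub> y)"
proof -
  interpret N: submodule N R M by fact
  interpret abelian_subgroup N M
    by (rule abelian_subgroupI3) (unfold_locales)
  show ?thesis using assms by (simp add: quot_lmod_def a_rcos_sum)
qed

lemma quot_lmod_left_module:
  assumes N: "submodule N R M"
  shows "left_module R (quot_lmod M N)"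
proof -
  interpret N: submodule N R M by fact
  have zero: "\<zero>\<^bsub>quot_lmod M N\<^esub> = N +>\<^bsub>M\<^esub> \<zero>\<^bsub>M\<^esub>"
    using M.add.coset_mult_one[OF N.subset[simplified]] by (simp add: quot_lmod_def a_r_coset_def)
  have carr: "carrier (quot_lmod M N) = (\<lambda>x. N +>\<^bsub>M\<^esub> x) ` carrier M"
    by (auto simp: quot_lmod_def A_RCOSETS_def')
  have "abelian_group (quot_lmod M N)"
  proof (rule abelian_groupI)
    fix X assume "X \<in> carrier (quot_lmod M N)"
    then obtain x where x: "x \<in> carrier M" "X = N +>\<^bsub>M\<^esub> x" unfolding carr by blast
    then have "(N +>\<^bsub>M\<^esub> (\<ominus>\<^bsub>M\<^esub> x)) \<oplus>\<^bsub>quot_lmod M N\<^esub> X = \<zero>\<^bsub>quot_lmod M N\<^esub>"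
      by (simp add: quot_lmod_add[OF N] zero M.l_neg)
    then show "\<exists>Y\<in>carrier (quot_lmod M N). Y \<oplus>\<^bsub>quot_lmod M N\<^esub> X = \<zero>\<^bsub>quot_lmod M N\<^esub>"
      using x by (auto simp: carr)
  next
    fix X Y Z
    assume "X \<in> carrier (quot_lmod M N)" "Y \<in> carrier (quot_lmod M N)" "Z \<in> carrier (quot_lmod M N)"
    then obtain x y z where "x \<in> carrier M" "X = N +>\<^bsub>M\<^esub> x" "y \<in> carrier M" "Y = N +>\<^bsub>M\<^esub> y"
      "z \<in> carrier M" "Z = N +>\<^bsub>M\<^esub> z" unfolding carr by blast
    then show "X \<oplus>\<^bsub>quot_lmod M N\<^esub> Y \<oplus>\<^bsub>quot_lmod M N\<^esub> Z = X \<oplus>\<^bsub>quot_lmod M N\<^esub> (Y \<oplus>\<^bsub>quot_lmod M N\<^esub> Z)"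
      by (simp add: quot_lmod_add[OF N] M.a_assoc)
  next
    fix X Y
    assume "X \<in> carrier (quot_lmod M N)" "Y \<in> carrier (quot_lmod M N)"
    then obtain x y where "x \<in> carrier M" "X = N +>\<^bsub>M\<^esub> x" "y \<in> carrier M" "Y = N +>\<^bsub>M\<^esub> y" unfolding carr by blast
    then show "X \<oplus>\<^bsub>quot_lmod M N\<^esub> Y = Y \<oplus>\<^bsub>quot_lmod M N\<^esub> X"
      by (simp add: quot_lmod_add[OF N] M.a_comm)
  next
    fix X Y
    assume "X \<in> carrier (quot_lmod M N)" "Y \<in> carrier (quot_lmod M N)"
    then obtain x y where "x \<in> carrier M" "X = N +>\<^bsub>M\<^esub> x" "y \<in> carrier M" "Y = N +>\<^bsub>M\<^esub> y" unfolding carr by blast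
    then show "X \<oplus>\<^bsub>quot_lmod M N\<^esub> Y \<in> carrier (quot_lmod M N)"
      by (simp add: quot_lmod_add[OF N] carr)
  next
    fix X assume "X \<in> carrier (quot_lmod M N)"
    then obtain x where "x \<in> carrier M" "X = N +>\<^bsub>M\<^esub> x" unfolding carr by blast
    then show "\<zero>\<^bsub>quot_lmod M N\<^esub> \<oplus>\<^bsub>quot_lmod M N\<^esub> X = X"
      by (simp add: quot_lmod_add[OF N] zero)
  next
    show "\<zero>\<^bsub>quot_lmod M N\<^esub> \<in> carrier (quot_lmod M N)" by (simp add: zero carr)
  qed
  moreover have "left_module_axioms R (quot_lmod M N)"
    unfolding left_module_axioms_def carr
    by (intro conjI allI impI; elim imageE;
      simp add: quot_lmod_smult[OF N] quot_lmod_add[OF N] smult_l_distr smult_r_distr smult_assoc1)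
  ultimately show ?thesis
    using R.ring_axioms by (simp add: left_module_def)
qed

end

lemma left_ideal_hom_extends:
  fixes R :: "('r, 'a) ring_scheme" and E :: "('r, 'e, 'b) module_scheme"
  assumes inj: "injective_lmod R E"
    and I: "I \<subseteq> carrier R" "\<zero>\<^bsub>R\<^esub> \<in> I"
      "\<And>x y. x \<in> I \<Longrightarrow> y \<in> I \<Longrightarrow> x \<oplus>\<^bsub>R\<^esub> y \<in> I"
      "\<And>a x. a \<in> carrier R \<Longrightarrow> x \<in> I \<Longrightarrow> a \<otimes>\<^bsub>R\<^esub> x \<in> I"
    and p: "\<And>x. x \<in> I \<Longrightarrow> p x \<in> carrier E"
      "\<And>x y. x \<in> I \<Longrightarrow> y \<in> I \<Longrightarrow> p (x \<oplus>\<^bsub>R\<^esub> y) = p x \<oplus>\<^bsub>E\<^esub> p y"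
      "\<And>a x. a \<in> carrier R \<Longrightarrow> x \<in> I \<Longrightarrow> p (a \<otimes>\<^bsub>R\<^esub> x) = a \<odot>\<^bsub>E\<^esub> p x"
  shows "\<exists>e\<in>carrier E. \<forall>x\<in>I. p x = x \<odot>\<^bsub>E\<^esub> e"
proof -
  interpret E: left_module R E using inj by (simp add: injective_lmod_def)
  define B :: "('r, 'r + 'e) module" where "B =
    \<lparr>carrier = Inl ` carrier R, mult = undefined, one = undefined, zero = Inl \<zero>\<^bsub>R\<^esub>,
     add = (\<lambda>x y. Inl (projl x \<oplus>\<^bsub>R\<^esub> projl y)), smult = (\<lambda>a x. Inl (a \<otimes>\<^bsub>R\<^esub> projl x))\<rparr>"
  have "abelian_group B"
  proof (rule abelian_groupI)
    fix x assume "x \<in> carrier B"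
    then obtain r where "r \<in> carrier R" "x = Inl r" by (auto simp: B_def)
    then show "\<exists>y\<in>carrier B. y \<oplus>\<^bsub>B\<^esub> x = \<zero>\<^bsub>B\<^esub>"
      by (auto simp: B_def E.R.l_neg intro!: bexI[of _ "\<ominus>\<^bsub>R\<^esub> r"])
  qed (auto simp: B_def E.R.a_ac)
  then interpret BG: abelian_group B .
  interpret B: left_module R B
    by unfold_locales (auto simp: B_def E.R.l_distr E.R.r_distr E.R.m_assoc)
  have "submodule (Inl ` I) R B"
    using I by (intro B.submoduleI_closed) (auto simp: B_def)
  then have A: "left_module R (sub_lmod B (Inl ` I))" by (rule B.sub_lmod_left_module)
  have f: "id \<in> lmod_mono R (sub_lmod B (Inl ` I)) B"
    using I(1) by (auto simp: lmod_mono_def lmod_hom_def B_def)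
  have g: "p \<circ> projl \<in> lmod_hom R (sub_lmod B (Inl ` I)) E"
    using p by (auto simp: lmod_hom_def B_def)
  have "\<exists>h\<in>lmod_hom R B E. \<forall>x\<in>carrier (sub_lmod B (Inl ` I)). h (id x) = (p \<circ> projl) x"
    using conjunct2[OF inj[unfolded injective_lmod_def],
        THEN spec, of "sub_lmod B (Inl ` I)", THEN spec, of B, THEN mp,
        OF conjI[OF A B.left_module_axioms], THEN bspec, OF f, THEN bspec, OF g] .
  then obtain h where h: "h \<in> lmod_hom R B E" "\<And>x. x \<in> I \<Longrightarrow> h (Inl x) = p x"
    unfolding comp_def id_def by (force simp: B_def)
  have "p x = x \<odot>\<^bsub>E\<^esub> h (Inl \<one>\<^bsub>R\<^esub>)" if x: "x \<in> I" for x
  proof -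
    have "x \<in> carrier R" using I(1) x by blast
    then show ?thesis
      using lmod_homD(3)[OF h(1), of x "Inl \<one>\<^bsub>R\<^esub>"] h(2)[OF x] by (simp add: B_def)
  qed
  moreover have "h (Inl \<one>\<^bsub>R\<^esub>) \<in> carrier E"
    by (rule lmod_homD(1)[OF h(1)]) (simp add: B_def)
  ultimately show ?thesis by blast
qed

theorem injective_lmod_extends:
  fixes R :: "('r, 'a) ring_scheme" and E :: "('r, 'e, 'b) module_scheme"
    and A :: "('r, 'u, 'c) module_scheme" and B :: "('r, 'v, 'd) module_scheme"
  assumes inj: "injective_lmod R E" and A: "left_module R A" and B: "left_module R B"
    and f: "f \<in> lmod_mono R A B" and g: "g \<in> lmod_hom R A E"
  shows "\<exists>h \<in> lmod_hom R B E. \<forall>x\<in>carrier A. h (f x) = g x"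
proof -
  interpret E: left_module R E using inj by (simp add: injective_lmod_def)
  interpret A: left_module R A by fact
  interpret B: left_module R B by fact
  have fh: "f \<in> lmod_hom R A B" and finj: "inj_on f (carrier A)"
    using f by (auto simp: lmod_mono_def)
  note fD = lmod_homD[OF fh] and gD = lmod_homD[OF g]
  have f0: "f \<zero>\<^bsub>A\<^esub> = \<zero>\<^bsub>B\<^esub>"
    using fD(3)[of "\<zero>\<^bsub>R\<^esub>" "\<zero>\<^bsub>A\<^esub>"] fD(1) by (simp add: A.smult_zero_left B.smult_zero_left)
  have g0: "g \<zero>\<^bsub>A\<^esub> = \<zero>\<^bsub>E\<^esub>"
    using gD(3)[of "\<zero>\<^bsub>R\<^esub>" "\<zero>\<^bsub>A\<^esub>"] gD(1) by (simp add: A.smult_zero_left E.smult_zero_left)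
  define G0 where "G0 = (\<lambda>x. (f x, g x)) ` carrier A"
  define good where "good G \<longleftrightarrow> G0 \<subseteq> G \<and> G \<subseteq> carrier B \<times> carrier E \<and>
     (\<forall>u v x y. (u, x) \<in> G \<and> (v, y) \<in> G \<longrightarrow> (u \<oplus>\<^bsub>B\<^esub> v, x \<oplus>\<^bsub>E\<^esub> y) \<in> G) \<and>
     (\<forall>a\<in>carrier R. \<forall>u x. (u, x) \<in> G \<longrightarrow> (a \<odot>\<^bsub>B\<^esub> u, a \<odot>\<^bsub>E\<^esub> x) \<in> G) \<and>
     (\<forall>y. (\<zero>\<^bsub>B\<^esub>, y) \<in> G \<longrightarrow> y = \<zero>\<^bsub>E\<^esub>)" for G
  have goodD: "G0 \<subseteq> G" "G \<subseteq> carrier B \<times> carrier E"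
    "\<And>u v x y. (u, x) \<in> G \<Longrightarrow> (v, y) \<in> G \<Longrightarrow> (u \<oplus>\<^bsub>B\<^esub> v, x \<oplus>\<^bsub>E\<^esub> y) \<in> G"
    "\<And>a u x. a \<in> carrier R \<Longrightarrow> (u, x) \<in> G \<Longrightarrow> (a \<odot>\<^bsub>B\<^esub> u, a \<odot>\<^bsub>E\<^esub> x) \<in> G"
    "\<And>y. (\<zero>\<^bsub>B\<^esub>, y) \<in> G \<Longrightarrow> y = \<zero>\<^bsub>E\<^esub>"
    if "good G" for G
    using that unfolding good_def by simp_all
  have "good G0"
    unfolding good_def
  proof (intro conjI allI impI ballI subset_refl)
    show "G0 \<subseteq> carrier B \<times> carrier E" using fD(1) gD(1) by (auto simp: G0_def)
  next
    fix u v x y assume "(u, x) \<in> G0 \<and> (v, y) \<in> G0"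
    then obtain z w where zw: "z \<in> carrier A" "w \<in> carrier A" "u = f z" "x = g z" "v = f w" "y = g w"
      unfolding G0_def by blast
    show "(u \<oplus>\<^bsub>B\<^esub> v, x \<oplus>\<^bsub>E\<^esub> y) \<in> G0"
      unfolding G0_def
      by (rule image_eqI[of _ _ "z \<oplus>\<^bsub>A\<^esub> w"]) (use zw fD(2)[of z w] gD(2)[of z w] in auto)
  next
    fix a u x assume a: "a \<in> carrier R" and "(u, x) \<in> G0"
    then obtain z where z: "z \<in> carrier A" "u = f z" "x = g z"
      unfolding G0_def by blast
    show "(a \<odot>\<^bsub>B\<^esub> u, a \<odot>\<^bsub>E\<^esub> x) \<in> G0"
      unfolding G0_def
      by (rule image_eqI[of _ _ "a \<odot>\<^bsub>A\<^esub> z"]) (use a z fD(3)[of a z] gD(3)[of a z] in auto)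
  next
    fix y assume "(\<zero>\<^bsub>B\<^esub>, y) \<in> G0"
    then obtain z where z: "z \<in> carrier A" "\<zero>\<^bsub>B\<^esub> = f z" "y = g z"
      unfolding G0_def by blast
    have "f z = f \<zero>\<^bsub>A\<^esub>" by (rule trans[OF z(2)[symmetric] f0[symmetric]])
    then have "z = \<zero>\<^bsub>A\<^esub>" using z(1) by (rule inj_onD[OF finj]) simp
    then show "y = \<zero>\<^bsub>E\<^esub>" using z(3) g0 by simp
  qed
  have "\<exists>G\<in>Collect good. \<forall>X\<in>Collect good. G \<subseteq> X \<longrightarrow> X = G"
  proof (rule subset_Zorn_nonempty)
    show "Collect good \<noteq> {}" using \<open>good G0\<close> by auto
    fix C assume C: "C \<noteq> {}" "subset.chain (Collect good) C"
    have gC: "good G" if "G \<in> C" for G using C(2) that by (auto simp: subset.chain_def)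
    have ch: "G \<subseteq> H \<or> H \<subseteq> G" if "G \<in> C" "H \<in> C" for G H
      using C(2) that by (auto simp: subset.chain_def)
    have "good (\<Union>C)"
      unfolding good_def
    proof (intro conjI allI impI ballI)
      obtain G where "G \<in> C" using C(1) by blast
      then show "G0 \<subseteq> \<Union>C" using goodD(1)[OF gC] by blast
      show "\<Union>C \<subseteq> carrier B \<times> carrier E" using goodD(2)[OF gC] by (intro Union_least)
    next
      fix u v x y assume uv: "(u, x) \<in> \<Union>C \<and> (v, y) \<in> \<Union>C"
      then obtain G H where GH: "G \<in> C" "H \<in> C" "(u, x) \<in> G" "(v, y) \<in> H" by blast
      then obtain K where K: "K \<in> C" "(u, x) \<in> K" "(v, y) \<in> K" using ch[of G H] by blast
      show "(u \<oplus>\<^bsub>B\<^esub> v, x \<oplus>\<^bsub>E\<^esub> y) \<in> \<Union>C"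
        by (rule UnionI[OF K(1) goodD(3)[OF gC[OF K(1)] K(2,3)]])
    next
      fix a u x assume a: "a \<in> carrier R" and "(u, x) \<in> \<Union>C"
      then obtain K where K: "K \<in> C" "(u, x) \<in> K" by blast
      show "(a \<odot>\<^bsub>B\<^esub> u, a \<odot>\<^bsub>E\<^esub> x) \<in> \<Union>C"
        by (rule UnionI[OF K(1) goodD(4)[OF gC[OF K(1)] a K(2)]])
    next
      fix y assume "(\<zero>\<^bsub>B\<^esub>, y) \<in> \<Union>C"
      then obtain K where K: "K \<in> C" "(\<zero>\<^bsub>B\<^esub>, y) \<in> K" by blast
      show "y = \<zero>\<^bsub>E\<^esub>" by (rule goodD(5)[OF gC[OF K(1)] K(2)])
    qed
    then show "\<Union>C \<in> Collect good" by simp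
  qed
  then obtain G where G: "good G" and max: "\<And>X. good X \<Longrightarrow> G \<subseteq> X \<Longrightarrow> X = G" by blast
  note GG0 = goodD(1)[OF G] and Gsub = goodD(2)[OF G] and Gadd = goodD(3)[OF G]
    and Gsm = goodD(4)[OF G] and Gz = goodD(5)[OF G]
  have Gc: "u \<in> carrier B" "x \<in> carrier E" if "(u, x) \<in> G" for u x using that Gsub by auto
  have Gneg: "(\<ominus>\<^bsub>B\<^esub> u, \<ominus>\<^bsub>E\<^esub> x) \<in> G" if "(u, x) \<in> G" for u x
    using Gsm[OF _ that, of "\<ominus>\<^bsub>R\<^esub> \<one>\<^bsub>R\<^esub>"] Gc[OF that] by (simp add: B.smult_neg_one E.smult_neg_one)
  have Guniq: "x = y" if "(u, x) \<in> G" "(u, y) \<in> G" for u x y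
  proof -
    have "(u \<oplus>\<^bsub>B\<^esub> \<ominus>\<^bsub>B\<^esub> u, x \<oplus>\<^bsub>E\<^esub> \<ominus>\<^bsub>E\<^esub> y) \<in> G" using that Gneg Gadd by blast
    then have "x \<oplus>\<^bsub>E\<^esub> \<ominus>\<^bsub>E\<^esub> y = \<zero>\<^bsub>E\<^esub>" using Gc that Gz by (simp add: B.M.r_neg)
    then show ?thesis using Gc that by (metis E.M.minus_equality E.M.minus_minus E.M.a_inv_closed)
  qed
  have G00: "(\<zero>\<^bsub>B\<^esub>, \<zero>\<^bsub>E\<^esub>) \<in> G" using GG0 f0 g0 by (force simp: G0_def)
  have dom: "b \<in> Domain G" if b: "b \<in> carrier B" for b
  proof -
    define I where "I = {r \<in> carrier R. r \<odot>\<^bsub>B\<^esub> b \<in> Domain G}"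
    define p where "p r = (THE x. (r \<odot>\<^bsub>B\<^esub> b, x) \<in> G)" for r
    have pI: "p r = x" if "(r \<odot>\<^bsub>B\<^esub> b, x) \<in> G" for r x
      unfolding p_def using that Guniq by blast
    have pG: "(r \<odot>\<^bsub>B\<^esub> b, p r) \<in> G" if "r \<in> I" for r
      using that pI by (auto simp: I_def)
    have Gs: "((r \<oplus>\<^bsub>R\<^esub> s) \<odot>\<^bsub>B\<^esub> b, p r \<oplus>\<^bsub>E\<^esub> p s) \<in> G" if "r \<in> I" "s \<in> I" for r s
      using Gadd[OF pG pG, OF that] that b by (simp add: I_def B.smult_l_distr)
    have Gm: "((a \<otimes>\<^bsub>R\<^esub> r) \<odot>\<^bsub>B\<^esub> b, a \<odot>\<^bsub>E\<^esub> p r) \<in> G" if "a \<in> carrier R" "r \<in> I" for a r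
      using Gsm[OF _ pG, of a r] that b by (simp add: I_def B.smult_assoc1)
    have "\<exists>e\<in>carrier E. \<forall>r\<in>I. p r = r \<odot>\<^bsub>E\<^esub> e"
    proof (rule left_ideal_hom_extends[OF inj])
      show "I \<subseteq> carrier R" by (auto simp: I_def)
      show "\<zero>\<^bsub>R\<^esub> \<in> I" using G00 b by (auto simp: I_def B.smult_zero_left)
      show "x \<oplus>\<^bsub>R\<^esub> y \<in> I" if "x \<in> I" "y \<in> I" for x y
        using Gs[OF that] that by (auto simp: I_def)
      show "a \<otimes>\<^bsub>R\<^esub> x \<in> I" if "a \<in> carrier R" "x \<in> I" for a x
        using Gm[OF that] that by (auto simp: I_def)
      show "p x \<in> carrier E" if "x \<in> I" for x using pG[OF that] Gc by blast
    qed (use Gs Gm pI in blast)+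
    then obtain e where e: "e \<in> carrier E" "\<And>r. r \<in> I \<Longrightarrow> p r = r \<odot>\<^bsub>E\<^esub> e" by blast
    define H where "H = {(u \<oplus>\<^bsub>B\<^esub> r \<odot>\<^bsub>B\<^esub> b, x \<oplus>\<^bsub>E\<^esub> r \<odot>\<^bsub>E\<^esub> e) | u x r. (u, x) \<in> G \<and> r \<in> carrier R}"
    have HI: "(u \<oplus>\<^bsub>B\<^esub> r \<odot>\<^bsub>B\<^esub> b, x \<oplus>\<^bsub>E\<^esub> r \<odot>\<^bsub>E\<^esub> e) \<in> H" if "(u, x) \<in> G" "r \<in> carrier R" for u x r
      using that by (auto simp: H_def)
    have GH: "G \<subseteq> H"
    proof
      fix z assume z: "z \<in> G"
      obtain u x where ux: "z = (u, x)" by (cases z)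
      show "z \<in> H" using HI[of u x "\<zero>\<^bsub>R\<^esub>"] z Gc[of u x] b e(1)
        by (simp add: ux B.smult_zero_left E.smult_zero_left)
    qed
    have "good H"
      unfolding good_def
    proof (intro conjI allI impI ballI)
      show "G0 \<subseteq> H" using GG0 GH by blast
      show "H \<subseteq> carrier B \<times> carrier E" using Gc b e(1) by (auto simp: H_def)
    next
      fix u v x y assume "(u, x) \<in> H \<and> (v, y) \<in> H"
      then obtain u' x' r v' y' s where *: "(u', x') \<in> G" "r \<in> carrier R" "(v', y') \<in> G" "s \<in> carrier R"
        "u = u' \<oplus>\<^bsub>B\<^esub> r \<odot>\<^bsub>B\<^esub> b" "x = x' \<oplus>\<^bsub>E\<^esub> r \<odot>\<^bsub>E\<^esub> e"
        "v = v' \<oplus>\<^bsub>B\<^esub> s \<odot>\<^bsub>B\<^esub> b" "y = y' \<oplus>\<^bsub>E\<^esub> s \<odot>\<^bsub>E\<^esub> e"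
        by (auto simp: H_def)
      have "u \<oplus>\<^bsub>B\<^esub> v = (u' \<oplus>\<^bsub>B\<^esub> v') \<oplus>\<^bsub>B\<^esub> (r \<oplus>\<^bsub>R\<^esub> s) \<odot>\<^bsub>B\<^esub> b"
        using * b Gc[OF *(1)] Gc[OF *(3)] by (simp add: B.smult_l_distr B.M.a_ac)
      moreover have "x \<oplus>\<^bsub>E\<^esub> y = (x' \<oplus>\<^bsub>E\<^esub> y') \<oplus>\<^bsub>E\<^esub> (r \<oplus>\<^bsub>R\<^esub> s) \<odot>\<^bsub>E\<^esub> e"
        using * e(1) Gc[OF *(1)] Gc[OF *(3)] by (simp add: E.smult_l_distr E.M.a_ac)
      ultimately show "(u \<oplus>\<^bsub>B\<^esub> v, x \<oplus>\<^bsub>E\<^esub> y) \<in> H"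
        using HI[OF Gadd[OF *(1,3)], of "r \<oplus>\<^bsub>R\<^esub> s"] * by simp
    next
      fix a u x assume a: "a \<in> carrier R" and "(u, x) \<in> H"
      then obtain u' x' r where *: "(u', x') \<in> G" "r \<in> carrier R"
        "u = u' \<oplus>\<^bsub>B\<^esub> r \<odot>\<^bsub>B\<^esub> b" "x = x' \<oplus>\<^bsub>E\<^esub> r \<odot>\<^bsub>E\<^esub> e" by (auto simp: H_def)
      show "(a \<odot>\<^bsub>B\<^esub> u, a \<odot>\<^bsub>E\<^esub> x) \<in> H"
        using HI[OF Gsm[OF a *(1)], of "a \<otimes>\<^bsub>R\<^esub> r"] * a b e(1) Gc[OF *(1)]
        by (simp add: B.smult_r_distr E.smult_r_distr B.smult_assoc1 E.smult_assoc1)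
    next
      fix y assume "(\<zero>\<^bsub>B\<^esub>, y) \<in> H"
      then obtain u x r where *: "(u, x) \<in> G" "r \<in> carrier R"
        "\<zero>\<^bsub>B\<^esub> = u \<oplus>\<^bsub>B\<^esub> r \<odot>\<^bsub>B\<^esub> b" "y = x \<oplus>\<^bsub>E\<^esub> r \<odot>\<^bsub>E\<^esub> e" by (auto simp: H_def)
      have "r \<odot>\<^bsub>B\<^esub> b = \<ominus>\<^bsub>B\<^esub> u"
        using * b Gc[OF *(1)] by (metis B.M.a_comm B.M.minus_equality B.smult_closed)
      then have "(r \<odot>\<^bsub>B\<^esub> b, \<ominus>\<^bsub>E\<^esub> x) \<in> G" using Gneg[OF *(1)] by simp
      then have "r \<in> I" "p r = \<ominus>\<^bsub>E\<^esub> x" using *(2) pI by (auto simp: I_def)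
      then have "r \<odot>\<^bsub>E\<^esub> e = \<ominus>\<^bsub>E\<^esub> x" using e(2) by simp
      then show "y = \<zero>\<^bsub>E\<^esub>" using *(4) Gc[OF *(1)] by (simp add: E.M.r_neg)
    qed
    then have "H = G" using max GH by blast
    moreover have "(b, e) \<in> H" using HI[OF G00, of "\<one>\<^bsub>R\<^esub>"] b e(1) by simp
    ultimately show ?thesis by blast
  qed
  define h where "h b = (THE x. (b, x) \<in> G)" for b
  have hI: "h b = x" if "(b, x) \<in> G" for b x
    unfolding h_def using that Guniq by blast
  have hG: "(b, h b) \<in> G" if "b \<in> carrier B" for b
    using dom[OF that] hI by auto
  have "h \<in> lmod_hom R B E"
    unfolding lmod_hom_def
  proof (intro CollectI conjI ballI funcsetI)
    show "h x \<in> carrier E" if "x \<in> carrier B" for x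
      by (rule Gc(2)[OF hG[OF that]])
    show "h (x \<oplus>\<^bsub>B\<^esub> y) = h x \<oplus>\<^bsub>E\<^esub> h y" if "x \<in> carrier B" "y \<in> carrier B" for x y
      by (rule hI[OF Gadd[OF hG[OF that(1)] hG[OF that(2)]]])
    show "h (a \<odot>\<^bsub>B\<^esub> x) = a \<odot>\<^bsub>E\<^esub> h x" if "a \<in> carrier R" "x \<in> carrier B" for a x
      by (rule hI[OF Gsm[OF that(1) hG[OF that(2)]]])
  qed
  moreover have "h (f x) = g x" if "x \<in> carrier A" for x
    using that GG0 by (intro hI) (auto simp: G0_def)
  ultimately show ?thesis by blast
qed

end

theory Submission
  imports Defs
begin

text \<open>
  If \<open>\<phi> : M \<rightarrow> M/N\<close> is a monomorphism and \<open>K\<close> is the preimage of \<open>\<phi> M\<close> in \<open>M\<close>, then \<open>\<phi>\<inverse>\<close> composed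
  with the projection is an epimorphism \<open>\<psi> : K \<rightarrow> M\<close> with kernel \<open>N\<close>.  By quasi-injectivity \<open>\<psi>\<close>
  extends to a homomorphism \<open>M \<rightarrow> M'\<close>.  It is nonzero because \<open>\<psi>\<close> is onto, and it kills \<open>N\<close>, so
  \<open>N = 0\<close> when all nonzero homomorphisms \<open>M \<rightarrow> M'\<close> are injective.
\<close>

lemma lmod_homI:
  assumes "\<And>x. x \<in> carrier M \<Longrightarrow> h x \<in> carrier N"
    and "\<And>x y. x \<in> carrier M \<Longrightarrow> y \<in> carrier M \<Longrightarrow> h (x \<oplus>\<^bsub>M\<^esub> y) = h x \<oplus>\<^bsub>N\<^esub> h y"
    and "\<And>a x. a \<in> carrier R \<Longrightarrow> x \<in> carrier M \<Longrightarrow> h (a \<odot>\<^bsub>M\<^esub> x) = a \<odot>\<^bsub>N\<^esub> h x"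
  shows "h \<in> lmod_hom R M N"
  using assms unfolding lmod_hom_def by auto

lemma lmod_hom_zero:
  assumes "left_module R M" "left_module R N" "h \<in> lmod_hom R M N"
  shows "h \<zero>\<^bsub>M\<^esub> = \<zero>\<^bsub>N\<^esub>"
proof -
  interpret M: left_module R M by fact
  interpret N: left_module R N by fact
  note h = lmod_homD[OF assms(3)]
  show ?thesis
    using h(3)[of "\<zero>\<^bsub>R\<^esub>" "\<zero>\<^bsub>M\<^esub>"] h(1)[of "\<zero>\<^bsub>M\<^esub>"]
    by (simp add: M.smult_zero_left N.smult_zero_left)
qed

lemma lmod_hom_comp:
  assumes f: "f \<in> lmod_hom R L M" and g: "g \<in> lmod_hom R M N"
  shows "(\<lambda>x. g (f x)) \<in> lmod_hom R L N"
  using lmod_homD[OF f] lmod_homD[OF g] by (intro lmod_homI) simp_all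

lemma lmod_hom_image_submodule:
  assumes "left_module R M" "left_module R N" "h \<in> lmod_hom R M N"
  shows "submodule (h ` carrier M) R N"
proof -
  interpret M: left_module R M by fact
  interpret N: left_module R N by fact
  note h = lmod_homD[OF assms(3)]
  have h0: "h \<zero>\<^bsub>M\<^esub> = \<zero>\<^bsub>N\<^esub>" by (rule lmod_hom_zero[OF assms])
  show ?thesis
  proof (rule N.submoduleI_closed)
    show "h ` carrier M \<subseteq> carrier N" using h(1) by auto
    show "\<zero>\<^bsub>N\<^esub> \<in> h ` carrier M"
      by (rule image_eqI[of _ _ "\<zero>\<^bsub>M\<^esub>"]) (simp_all add: h0)
    show "x \<oplus>\<^bsub>N\<^esub> y \<in> h ` carrier M" if "x \<in> h ` carrier M" "y \<in> h ` carrier M" for x y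
      using that by (auto simp flip: h(2))
    show "a \<odot>\<^bsub>N\<^esub> x \<in> h ` carrier M" if "a \<in> carrier R" "x \<in> h ` carrier M" for a x
      using that by (auto simp flip: h(3))
  qed
qed

text \<open>Sums and multiples of values of \<open>f\<close> are again values of \<open>f\<close>,
  and injectivity lets \<open>inv_into\<close> cancel \<open>f\<close> on them.\<close>

lemma lmod_mono_inverse:
  assumes "left_module R M" and f: "f \<in> lmod_mono R M N"
  shows "inv_into (carrier M) f \<in> lmod_hom R (sub_lmod N (f ` carrier M)) M"
proof -
  interpret M: left_module R M by fact
  have fh: "f \<in> lmod_hom R M N" and inj: "inj_on f (carrier M)"
    using f by (auto simp: lmod_mono_def)
  note fD = lmod_homD[OF fh]
  show ?thesis
    by (rule lmod_homI) (auto simp: inj simp flip: fD(2,3))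
qed

lemma lmod_hom_preimage_submodule:
  assumes "left_module R M" "left_module R N" "h \<in> lmod_hom R M N" "submodule P R N"
  shows "submodule {x \<in> carrier M. h x \<in> P} R M"
proof -
  interpret M: left_module R M by fact
  interpret N: left_module R N by fact
  interpret P: submodule P R N by fact
  note h = lmod_homD[OF assms(3)]
  show ?thesis
    by (rule M.submoduleI_closed)
      (use P.one_closed P.m_closed P.smult_closed lmod_hom_zero[OF assms(1-3)] in \<open>auto simp: h\<close>)
qed

lemma lmod_hom_restrict:
  assumes f: "f \<in> lmod_hom R M N" and "K \<subseteq> carrier M" "\<And>x. x \<in> K \<Longrightarrow> f x \<in> P"
  shows "f \<in> lmod_hom R (sub_lmod M K) (sub_lmod N P)"
  using assms by (intro lmod_homI) (auto simp: lmod_homD[OF f] subset_iff)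

lemma quasi_injective_extends:
  assumes "left_module R M" and Q: "quasi_injective R Q" and i: "i \<in> lmod_mono R M Q"
    and K: "submodule K R M" and g: "g \<in> lmod_hom R (sub_lmod M K) Q"
  shows "\<exists>h \<in> lmod_hom R M Q. \<forall>x\<in>K. h x = g x"
proof -
  interpret M: left_module R M by fact
  interpret K: submodule K R M by fact
  have lQ: "left_module R Q" using Q by (simp add: quasi_injective_def)
  have lK: "left_module R (sub_lmod M K)" by (rule M.sub_lmod_left_module[OF K])
  have Ksub: "K \<subseteq> carrier M" using K.subset by simp
  have ih: "i \<in> lmod_hom R M Q" and inj: "inj_on i (carrier M)"
    using i by (auto simp: lmod_mono_def)
  have iKh: "i \<in> lmod_hom R (sub_lmod M K) Q"
    \<comment> \<open>Only the domain shrinks: with \<open>carrier Q\<close> as the target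
      submodule, the codomain remains \<open>Q\<close>.\<close>
    using lmod_hom_restrict[OF ih Ksub, of "carrier Q"] lmod_homD(1)[OF ih] Ksub by auto
  then have iK: "i \<in> lmod_mono R (sub_lmod M K) Q"
    using inj_on_subset[OF inj Ksub] by (simp add: lmod_mono_def)
  have sub: "submodule (i ` K) R Q"
    using lmod_hom_image_submodule[OF lK lQ iKh] by simp
  have "(\<lambda>x. g (inv_into K i x)) \<in> lmod_hom R (sub_lmod Q (i ` K)) Q"
    using lmod_hom_comp[OF lmod_mono_inverse[OF lK iK] g] by simp
  then have "\<exists>h \<in> lmod_hom R Q Q. \<forall>x\<in>i ` K. h x = g (inv_into K i x)"
    using conjunct2[OF Q[unfolded quasi_injective_def], THEN spec, THEN mp, OF sub] by (rule bspec[rotated])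
  then obtain h where h: "h \<in> lmod_hom R Q Q" "\<And>x. x \<in> i ` K \<Longrightarrow> h x = g (inv_into K i x)"
    by auto
  have "h (i x) = g x" if "x \<in> K" for x
    using h(2)[of "i x"] that inv_into_f_f[OF inj_on_subset[OF inj Ksub]] by simp
  then show ?thesis by (intro bexI[OF _ lmod_hom_comp[OF ih h(1)]]) simp
qed

lemma (in left_module) quot_lmod_proj:
  assumes "submodule N R M"
  shows "(\<lambda>x. N +>\<^bsub>M\<^esub> x) \<in> lmod_hom R M (quot_lmod M N)"
  \<comment> \<open>The first \<open>auto\<close> computes with cosets through the rules for sums
    and multiples; the unfolding that follows shows that cosets lie in the carrier.\<close>
  by (rule lmod_homI)
    (auto simp: quot_lmod_add[OF assms] quot_lmod_smult[OF assms], auto simp: quot_lmod_def A_RCOSETS_def')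

theorem proposition2p12:
  fixes R :: "('r, 'a) ring_scheme"
    and M :: "('r, 'm, 'b) module_scheme"
    and E :: "('r, 'e, 'c) module_scheme"
    and \<iota> :: "'m \<Rightarrow> 'e"
    and M' :: "'e set"
  assumes "ring R" and "\<one>\<^bsub>R\<^esub> \<noteq> \<zero>\<^bsub>R\<^esub>"
    and "compressible R M"
    and "quasi_injective_hull R M E \<iota> M'"
    and "\<And>f. \<lbrakk>f \<in> lmod_hom R M (sub_lmod E M'); \<exists>x\<in>carrier M. f x \<noteq> \<zero>\<^bsub>E\<^esub>\<rbrakk>
          \<Longrightarrow> f \<in> lmod_mono R M (sub_lmod E M')"
  shows "critically_compressible R M"
proof -
  have cM: "left_module R M" "carrier M \<noteq> {\<zero>\<^bsub>M\<^esub>}"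
    using assms(3) by (auto simp: compressible_def)
  interpret M: left_module R M by (rule cM)
  define Q where "Q = sub_lmod E M'"
  have Q: "quasi_injective R Q" and "injective_hull R M E \<iota>" and iM: "\<iota> ` carrier M \<subseteq> M'"
    using assms(4) by (auto simp: quasi_injective_hull_def Q_def)
  then have "\<iota> \<in> lmod_mono R M E" by (simp add: injective_hull_def)
  then have i: "\<iota> \<in> lmod_mono R M Q"
    using iM by (auto simp: lmod_mono_def lmod_hom_def Q_def)
  have lQ: "left_module R Q" using Q by (simp add: quasi_injective_def)
  have ih: "\<iota> \<in> lmod_hom R M Q" and iinj: "inj_on \<iota> (carrier M)"
    using i by (auto simp: lmod_mono_def)
  have i0: "\<iota> \<zero>\<^bsub>M\<^esub> = \<zero>\<^bsub>Q\<^esub>" by (rule lmod_hom_zero[OF cM(1) lQ ih])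
  have "N = {\<zero>\<^bsub>M\<^esub>}" if N: "submodule N R M" and \<phi>: "\<phi> \<in> lmod_mono R M (quot_lmod M N)" for N \<phi>
  proof -
    interpret N: submodule N R M by fact
    have \<phi>h: "\<phi> \<in> lmod_hom R M (quot_lmod M N)" and \<phi>inj: "inj_on \<phi> (carrier M)"
      using \<phi> by (auto simp: lmod_mono_def)
    note lN = M.quot_lmod_left_module[OF N] and proj = M.quot_lmod_proj[OF N]
    define K where "K = {x \<in> carrier M. N +>\<^bsub>M\<^esub> x \<in> \<phi> ` carrier M}"
    \<comment> \<open>The value is meaningful only for \<open>x\<close> in \<open>K\<close>, where
      the coset of \<open>x\<close> has a preimage under \<open>\<phi>\<close>; elsewhere it is
      arbitrary.\<close>
    define \<psi> where "\<psi> x = inv_into (carrier M) \<phi> (N +>\<^bsub>M\<^esub> x)" for x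
    have K: "submodule K R M"
      unfolding K_def
      by (rule lmod_hom_preimage_submodule[OF cM(1) lN proj lmod_hom_image_submodule[OF cM(1) lN \<phi>h]])
    \<comment> \<open>On \<open>K\<close> the projection lands in the image of
      \<open>\<phi>\<close>, so it can be followed by the inverse of \<open>\<phi>\<close> and then
      by \<open>\<iota>\<close>.\<close>
    have "(\<lambda>x. N +>\<^bsub>M\<^esub> x) \<in> lmod_hom R (sub_lmod M K) (sub_lmod (quot_lmod M N) (\<phi> ` carrier M))"
      by (rule lmod_hom_restrict[OF proj]) (auto simp: K_def)
    from lmod_hom_comp[OF lmod_hom_comp[OF this lmod_mono_inverse[OF cM(1) \<phi>]] ih]
    have "(\<lambda>x. \<iota> (\<psi> x)) \<in> lmod_hom R (sub_lmod M K) Q" by (simp add: \<psi>_def)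
    then obtain h where h: "h \<in> lmod_hom R M Q" and hK: "\<And>x. x \<in> K \<Longrightarrow> h x = \<iota> (\<psi> x)"
      using quasi_injective_extends[OF cM(1) Q i K] by blast
    \<comment> \<open>Any representative of the coset \<open>\<phi> y\<close> lies in
      \<open>K\<close>, and \<open>\<psi>\<close> sends it to \<open>y\<close> because
      \<open>\<phi>\<close> is injective.\<close>
    have onto: "\<exists>x\<in>K. \<psi> x = y" if y: "y \<in> carrier M" for y
    proof -
      have "\<phi> y \<in> carrier (quot_lmod M N)" by (rule lmod_homD(1)[OF \<phi>h y])
      then obtain x where x: "x \<in> carrier M" "\<phi> y = N +>\<^bsub>M\<^esub> x"
        by (auto simp: quot_lmod_def A_RCOSETS_def')
      moreover have "\<psi> x = y"
        using y \<phi>inj by (simp add: \<psi>_def flip: x(2))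
      ultimately show ?thesis using y by (force simp: K_def)
    qed
    \<comment> \<open>A nonzero \<open>y\<close> exists since a compressible module is nonzero. A
      preimage \<open>x\<close> of it under \<open>\<psi>\<close> gives
      \<open>h x = \<iota> y\<close>, which is nonzero, so the hypothesis on homomorphisms applies
      to \<open>h\<close>.\<close>
    obtain y where y: "y \<in> carrier M" "y \<noteq> \<zero>\<^bsub>M\<^esub>" using cM(2) by blast
    obtain x where x: "x \<in> K" "\<psi> x = y" using onto[OF y(1)] by blast
    have "\<iota> y \<noteq> \<zero>\<^bsub>Q\<^esub>" using y inj_onD[OF iinj, of y "\<zero>\<^bsub>M\<^esub>"] i0 by auto
    then have "\<exists>x\<in>carrier M. h x \<noteq> \<zero>\<^bsub>E\<^esub>"
      using x hK by (intro bexI[of _ x]) (auto simp: K_def Q_def)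
    then have hinj: "inj_on h (carrier M)"
      using assms(5)[of h] h by (simp add: Q_def lmod_mono_def)
    have "n = \<zero>\<^bsub>M\<^esub>" if n: "n \<in> N" for n
    proof -
      have nc: "n \<in> carrier M" using n N.subset by auto
      have zero: "\<phi> \<zero>\<^bsub>M\<^esub> = N"
        using lmod_hom_zero[OF cM(1) lN \<phi>h] by (simp add: quot_lmod_def)
      have "N +>\<^bsub>M\<^esub> n = N"
        using M.add.coset_join2[OF nc N.subgroup_axioms n] by (simp add: a_r_coset_def)
      also have "N = \<phi> \<zero>\<^bsub>M\<^esub>" by (simp add: zero)
      finally have c: "N +>\<^bsub>M\<^esub> n = \<phi> \<zero>\<^bsub>M\<^esub>" .
      \<comment> \<open>The coset of \<open>n\<close> is the zero coset, which \<open>\<phi>\<close>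
        attains at zero. Hence \<open>N\<close> lies in \<open>K\<close> and \<open>\<psi>\<close>
        vanishes on it.\<close>
      then have "n \<in> K" using nc by (auto simp: K_def)
      moreover have "\<psi> n = \<zero>\<^bsub>M\<^esub>" using c \<phi>inj by (simp add: \<psi>_def)
      ultimately have "h n = h \<zero>\<^bsub>M\<^esub>"
        using hK i0 lmod_hom_zero[OF cM(1) lQ h] by simp
      then show ?thesis using inj_onD[OF hinj] nc by simp
    qed
    moreover have "\<zero>\<^bsub>M\<^esub> \<in> N" using N.one_closed by simp
    ultimately show ?thesis by blast
  qed
  then show ?thesis
    using assms(3) unfolding critically_compressible_def by blast
qed

end
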